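(* Let $\mathcal{B}$ be a building set on a finite set $X$, and let $\mathcal{S}(\mathcal{B})=\{S\subsetneq X: S\cap M\subsetneq M \text{ for all } M\in\mathcal{B}_{\max}\}$. Then the $f$-polynomials of nested complexes satisfy $f_{\mathcal{N}(\varnothing)}(t)=1$ for the empty building set, and $$f_{\mathcal{N}(\mathcal{B})}(t)=\sum_{S\in\mathcal{S}(\mathcal{B})}t^{|(\mathcal{B}|_S)_{\max}|}f_{\mathcal{N}(\mathcal{B}|_S)}(t).$$
   Context: A building set on a finite set $X$ is a collection $\mathcal{B}$ of nonempty subsets of $X$ containing all singletons and such that $I\cup J\in\mathcal{B}$ whenever $I,J\in\mathcal{B}$, $I\cap J\neq\varnothing$; $\mathcal{B}_{\max}$ is its set of inclusion-maximal elements; for $S\subseteq X$, $\mathcal{B}|_S=\{J\in\mathcal{B}:J\subseteq S\}$ is a building set on $S$. A nested collection is a subset $N\subseteq\mathcal{B}\setminus\mathcal{B}_{\max}$ whose members are pairwise nested or disjoint and such that no union of $k\ge2$ pairwise disjoint members lies in $\mathcal{B}$; the nested complex $\mathcal{N}(\mathcal{B})$ is the simplicial complex whose faces are the nested collections. Its $f$-polynomial is $f_{\mathcal{N}(\mathcal{B})}(t)=\sum_{N}t^{|N|}$, the sum over all nested collections $N$ (including $N=\varnothing$).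
   Formalization: The recursion is stated for nonempty X only: for X = ∅ the index set S(B) is empty, so the right-hand side would be 0 while the f-polynomial is 1; that case is covered by the separate initial condition for the empty building set. *)

theory Defs
  imports "HOL-Computational_Algebra.Polynomial" "HOL-Library.Disjoint_Sets"
begin

definition building_set :: "'a set \<Rightarrow> 'a set set \<Rightarrow> bool" where
  "building_set X B \<longleftrightarrow>
     B \<subseteq> Pow X \<and> {} \<notin> B \<and> (\<forall>x\<in>X. {x} \<in> B) \<and>
     (\<forall>I\<in>B. \<forall>J\<in>B. I \<inter> J \<noteq> {} \<longrightarrow> I \<union> J \<in> B)"

definition max_elems :: "'a set set \<Rightarrow> 'a set set" where
  "max_elems B = {M \<in> B. \<forall>J\<in>B. M \<subseteq> J \<longrightarrow> J = M}"

definition restrict_to :: "'a set set \<Rightarrow> 'a set \<Rightarrow> 'a set set" where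
  "restrict_to B S = {J \<in> B. J \<subseteq> S}"

text \<open>
  A family of \<open>k \<ge> 2\<close> pairwise disjoint members of \<open>N\<close> is encoded as a subset \<open>C\<close> of \<open>N\<close> with
  \<open>card C \<ge> 2\<close>. Since members of a building set are nonempty, pairwise disjoint members are
  automatically distinct, so no families are lost. (\<open>card C \<ge> 2\<close> forces \<open>C\<close> to be finite.)
\<close>
definition nested_collection :: "'a set set \<Rightarrow> 'a set set \<Rightarrow> bool" where
  "nested_collection B N \<longleftrightarrow>
     N \<subseteq> B - max_elems B \<and>
     (\<forall>I\<in>N. \<forall>J\<in>N. I \<subseteq> J \<or> J \<subseteq> I \<or> I \<inter> J = {}) \<and>
     (\<forall>C\<subseteq>N. card C \<ge> 2 \<and> disjoint C \<longrightarrow> \<Union>C \<notin> B)"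

text \<open>An abstract simplicial complex is represented by its set of faces (with the empty face).\<close>
definition nested_complex :: "'a set set \<Rightarrow> 'a set set set" where
  "nested_complex B = {N. nested_collection B N}"

text \<open>The face \<open>N\<close> contributes \<open>t ^ card N\<close>, where \<open>monom 1 n\<close> is the polynomial \<open>t ^ n\<close>.\<close>
definition f_polynomial :: "'v set set \<Rightarrow> int poly" where
  "f_polynomial K = (\<Sum>N\<in>K. monom 1 (card N))"

definition proper_trace_subsets :: "'a set \<Rightarrow> 'a set set \<Rightarrow> 'a set set" where
  "proper_trace_subsets X B = {S. S \<subset> X \<and> (\<forall>M\<in>max_elems B. S \<inter> M \<subset> M)}"

lemma building_set_empty_iff: "building_set {} B \<longleftrightarrow> B = {}"
  unfolding building_set_def by auto

lemma building_set_restrict_to: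
  assumes "building_set X B" "S \<subseteq> X"
  shows "building_set S (restrict_to B S)"
  using assms unfolding building_set_def restrict_to_def by (auto simp: subset_iff)

lemma nested_complex_downward_closed:
  assumes "N \<in> nested_complex B" "N' \<subseteq> N"
  shows "N' \<in> nested_complex B"
proof -
  have "N \<subseteq> B - max_elems B"
    and "\<forall>I\<in>N. \<forall>J\<in>N. I \<subseteq> J \<or> J \<subseteq> I \<or> I \<inter> J = {}"
    and "\<forall>C\<subseteq>N. card C \<ge> 2 \<and> disjoint C \<longrightarrow> \<Union>C \<notin> B"
    using assms(1) unfolding nested_complex_def nested_collection_def by auto
  then show ?thesis
    using assms(2) unfolding nested_complex_def nested_collection_def mem_Collect_eq
    by (meson subset_iff subset_trans)
qed

lemma empty_in_nested_complex: "{} \<in> nested_complex B"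
  unfolding nested_complex_def nested_collection_def by auto

lemma finite_nested_complex:
  assumes "finite X" "building_set X B"
  shows "finite (nested_complex B)"
proof -
  have "finite B"
    using assms unfolding building_set_def by (meson finite_Pow_iff finite_subset)
  moreover have "nested_complex B \<subseteq> Pow B"
    unfolding nested_complex_def nested_collection_def by auto
  ultimately show ?thesis
    by (meson finite_Pow_iff finite_subset)
qed

end

theory Submission
  imports Defs
begin

text \<open>
  Group the nested collections \<open>N\<close> by their union \<open>S\<close>. The maximal members of \<open>N\<close> are exactly
  the maximal members of \<open>B|\<^sub>S\<close>: any \<open>J \<in> B\<close> with \<open>J \<subseteq> S\<close> joins the maximal members of \<open>N\<close> that
  it meets into one member of \<open>B\<close>, so it meets only one of them and lies inside it. Removing
  these maximal members is therefore a bijection from the nested collections with union \<open>S\<close> onto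
  the nested collections of \<open>B|\<^sub>S\<close>.
\<close>

section \<open>Maximal members and unions in a building set\<close>

lemma finite_building_set:
  assumes "finite X" "building_set X B"
  shows "finite B"
  using assms unfolding building_set_def by (meson finite_Pow_iff finite_subset)

lemma max_elems_subset: "max_elems B \<subseteq> B"
  unfolding max_elems_def by auto

lemma max_elems_eqI: "M \<in> max_elems B \<Longrightarrow> J \<in> B \<Longrightarrow> M \<subseteq> J \<Longrightarrow> J = M"
  unfolding max_elems_def by auto

lemma ex_max_elem_superset:
  assumes "finite B" "J \<in> B"
  obtains M where "M \<in> max_elems B" "J \<subseteq> M"
proof -
  obtain M where "M \<in> B" "J \<subseteq> M" "\<forall>I\<in>B. M \<subseteq> I \<longrightarrow> M = I"
    using finite_has_maximal2[OF assms] by auto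
  then show thesis
    using that[of M] unfolding max_elems_def by auto
qed

text \<open>A set meeting \<open>M\<close> can be joined to \<open>M\<close> inside
  \<open>B\<close>, and maximality absorbs the join. This makes maximal members compatible with
  every other member of the building set.\<close>

lemma max_elems_subset_or_disjoint:
  assumes "building_set X B" "M \<in> max_elems B" "J \<in> B"
  shows "J \<subseteq> M \<or> J \<inter> M = {}"
proof (rule disjCI)
  assume "J \<inter> M \<noteq> {}"
  then have "M \<union> J \<in> B"
    using assms unfolding building_set_def max_elems_def by blast
  then have "M \<union> J = M"
    using assms(2) max_elems_eqI by (meson Un_upper1)
  then show "J \<subseteq> M" by blast
qed

text \<open>Here \<open>J\<close> serves as a hub: the members of \<open>C\<close> may be disjoint
  from each other, but added one at a time each meets the union built so far, because it meets
  \<open>J\<close>.\<close>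

lemma building_set_Un_Union:
  assumes "building_set X B" "J \<in> B" "finite C" "C \<subseteq> B" "\<forall>I\<in>C. I \<inter> J \<noteq> {}"
  shows "J \<union> \<Union>C \<in> B"
  using assms(3-5)
proof (induction C rule: finite_induct)
  case empty
  then show ?case using assms(2) by simp
next
  case (insert I C)
  then have "J \<union> \<Union>C \<in> B" "I \<in> B" "(J \<union> \<Union>C) \<inter> I \<noteq> {}"
    by auto
  moreover have "\<forall>I\<in>B. \<forall>J\<in>B. I \<inter> J \<noteq> {} \<longrightarrow> I \<union> J \<in> B"
    using assms(1) unfolding building_set_def by simp
  ultimately have "(J \<union> \<Union>C) \<union> I \<in> B"
    by metis
  then show ?case by (simp add: Un_ac)
qed

section \<open>Nested collections and the members of \<open>B\<close> below their union\<close>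

lemma nested_collection_subset: "nested_collection B N \<Longrightarrow> N \<subseteq> B - max_elems B"
  unfolding nested_collection_def by simp

lemma nested_collection_laminar:
  "nested_collection B N \<Longrightarrow> I \<in> N \<Longrightarrow> J \<in> N \<Longrightarrow> I \<subseteq> J \<or> J \<subseteq> I \<or> I \<inter> J = {}"
  unfolding nested_collection_def by simp

lemma nested_collection_Union_notin:
  "nested_collection B N \<Longrightarrow> C \<subseteq> N \<Longrightarrow> 2 \<le> card C \<Longrightarrow> disjoint C \<Longrightarrow> \<Union>C \<notin> B"
  unfolding nested_collection_def by simp

text \<open>The maximal members of \<open>N\<close> that meet \<open>J\<close> cover
  \<open>J\<close>, so joining them through \<open>J\<close> puts their union in \<open>B\<close>.
  They are pairwise disjoint, so nestedness forbids two or more; since \<open>J\<close> is nonempty,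
  exactly one remains.\<close>

lemma subset_member_of_nested_collection:
  assumes fin: "finite X" and bs: "building_set X B" and N: "nested_collection B N"
    and J: "J \<in> B" "J \<subseteq> \<Union>N"
  obtains I where "I \<in> N" "J \<subseteq> I"
proof -
  have NB: "N \<subseteq> B"
    using nested_collection_subset[OF N] by blast
  then have "finite N"
    using finite_building_set[OF fin bs] finite_subset by blast
  define C where "C = {I \<in> max_elems N. I \<inter> J \<noteq> {}}"
  have CN: "C \<subseteq> N"
    unfolding C_def using max_elems_subset by blast
  then have "finite C"
    using \<open>finite N\<close> finite_subset by blast
  have cover: "J \<subseteq> \<Union>C"
  proof
    fix x assume "x \<in> J"
    then obtain I where "I \<in> N" "x \<in> I"
      using J(2) by blast
    then obtain M where "M \<in> max_elems N" "I \<subseteq> M"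
      using ex_max_elem_superset[OF \<open>finite N\<close>] by metis
    then show "x \<in> \<Union>C"
      using \<open>x \<in> I\<close> \<open>x \<in> J\<close> unfolding C_def by blast
  qed
  have "J \<union> \<Union>C \<in> B"
    using building_set_Un_Union[OF bs J(1) \<open>finite C\<close>] CN NB unfolding C_def by blast
  then have "\<Union>C \<in> B"
    using cover by (simp add: Un_absorb1)
  moreover have "disjoint C"
  proof (rule disjointI)
    fix I I' assume I: "I \<in> C" "I' \<in> C" "I \<noteq> I'"
    then have "I \<in> max_elems N" "I' \<in> max_elems N"
      unfolding C_def by auto
    then have "\<not> I \<subseteq> I'" "\<not> I' \<subseteq> I"
      using I CN max_elems_eqI by (metis subsetD)+
    then show "I \<inter> I' = {}"
      using nested_collection_laminar[OF N] I CN by blast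
  qed
  ultimately have "\<not> 2 \<le> card C"
    using nested_collection_Union_notin[OF N CN] by blast
  moreover have "C \<noteq> {}"
    using cover J(1) bs unfolding building_set_def by auto
  \<comment> \<open>\<open>card\<close> is also 0 on infinite sets, so finiteness of
    \<open>C\<close> enters here.\<close>
  then have "card C \<noteq> 0"
    using \<open>finite C\<close> by simp
  ultimately have "card C = 1"
    by linarith
  then obtain I where "C = {I}"
    using card_1_singletonE by blast
  then show thesis
    using that[of I] CN cover by auto
qed

text \<open>Such a maximal set lies below some \<open>I\<close> in \<open>N\<close>; as
  \<open>I\<close> itself belongs to the restriction, maximality makes the two equal. Hence nothing
  is lost when these sets are removed from \<open>N\<close> and added back.\<close>

lemma max_elems_restrict_to_Union_subset:
  assumes "finite X" "building_set X B" "nested_collection B N"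
  shows "max_elems (restrict_to B (\<Union>N)) \<subseteq> N"
proof
  fix M assume M: "M \<in> max_elems (restrict_to B (\<Union>N))"
  then have "M \<in> B" "M \<subseteq> \<Union>N"
    using max_elems_subset[of "restrict_to B (\<Union>N)"] unfolding restrict_to_def by blast+
  then obtain I where I: "I \<in> N" "M \<subseteq> I"
    using subset_member_of_nested_collection[OF assms] by metis
  moreover have "I \<in> restrict_to B (\<Union>N)"
    using I nested_collection_subset[OF assms(3)] unfolding restrict_to_def by blast
  ultimately show "M \<in> N"
    using max_elems_eqI[OF M] by blast
qed

text \<open>A maximal member of \<open>B\<close> contained in \<open>\<Union>N\<close> would lie
  below a single member of \<open>N\<close>, but no member of \<open>N\<close> is maximal in
  \<open>B\<close>.\<close>

lemma Union_nested_collection_in_proper_trace_subsets: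
  assumes "finite X" "building_set X B" "X \<noteq> {}" "nested_collection B N"
  shows "\<Union>N \<in> proper_trace_subsets X B"
proof -
  have NB: "N \<subseteq> B - max_elems B"
    using nested_collection_subset[OF assms(4)] .
  have not_sub: "\<not> M \<subseteq> \<Union>N" if M: "M \<in> max_elems B" for M
  proof
    assume "M \<subseteq> \<Union>N"
    moreover have "M \<in> B"
      using M max_elems_subset by blast
    ultimately obtain I where "I \<in> N" "M \<subseteq> I"
      using subset_member_of_nested_collection[OF assms(1,2,4)] by metis
    then show False
      using NB M max_elems_eqI by blast
  qed
  \<comment> \<open>Strictness of \<open>\<Union>N \<subset> X\<close> requires at least one maximal
    member of \<open>B\<close>; a point of \<open>X\<close> supplies it through its
    singleton.\<close>
  obtain x where "x \<in> X"
    using assms(3) by blast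
  then have "{x} \<in> B"
    using assms(2) unfolding building_set_def by blast
  then obtain M where M: "M \<in> max_elems B"
    using ex_max_elem_superset[OF finite_building_set[OF assms(1,2)]] by metis
  then have "M \<subseteq> X"
    using max_elems_subset assms(2) unfolding building_set_def by blast
  moreover have "\<Union>N \<subseteq> X"
    using NB assms(2) unfolding building_set_def by blast
  ultimately have "\<Union>N \<subset> X"
    using not_sub[OF M] by blast
  then show ?thesis
    using not_sub unfolding proper_trace_subsets_def by blast
qed

section \<open>Removing and adding back the maximal members of a restriction\<close>

lemma nested_collection_Diff_max_elems:
  assumes "nested_collection B N"
  shows "nested_collection (restrict_to B (\<Union>N)) (N - max_elems (restrict_to B (\<Union>N)))"
  unfolding nested_collection_def
proof (intro conjI ballI allI impI)
  show "N - max_elems (restrict_to B (\<Union>N))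
      \<subseteq> restrict_to B (\<Union>N) - max_elems (restrict_to B (\<Union>N))"
    using nested_collection_subset[OF assms] unfolding restrict_to_def by blast
next
  fix I J
  assume "I \<in> N - max_elems (restrict_to B (\<Union>N))" "J \<in> N - max_elems (restrict_to B (\<Union>N))"
  then show "I \<subseteq> J \<or> J \<subseteq> I \<or> I \<inter> J = {}"
    using nested_collection_laminar[OF assms] by simp
next
  fix C
  assume "C \<subseteq> N - max_elems (restrict_to B (\<Union>N))" "2 \<le> card C \<and> disjoint C"
  then have "\<Union>C \<notin> B"
    using nested_collection_Union_notin[OF assms, of C] by blast
  then show "\<Union>C \<notin> restrict_to B (\<Union>N)"
    unfolding restrict_to_def by blast
qed

text \<open>This makes the inverse map well defined. The new sets are compatible with everything in
  the restriction, and a disjoint family containing one of them cannot have its union in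
  \<open>B\<close> unless it is a single set.\<close>

lemma nested_collection_Un_max_elems:
  assumes bs: "building_set X B" and S: "S \<in> proper_trace_subsets X B"
    and N: "nested_collection (restrict_to B S) N"
  shows "nested_collection B (N \<union> max_elems (restrict_to B S))"
proof -
  let ?R = "restrict_to B S"
  have R: "building_set S ?R"
    using building_set_restrict_to[OF bs] S unfolding proper_trace_subsets_def by blast
  have NR: "N \<union> max_elems ?R \<subseteq> ?R"
    using nested_collection_subset[OF N] max_elems_subset[of ?R] by blast
  \<comment> \<open>The trace condition on \<open>S\<close> says that \<open>S\<close> contains no
    maximal member of \<open>B\<close>; hence even the maximal members of the restriction are not
    maximal in \<open>B\<close>.\<close>
  have "\<not> J \<subseteq> S" if "J \<in> max_elems B" for J
    using S that unfolding proper_trace_subsets_def by blast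
  then have "?R \<subseteq> B - max_elems B"
    unfolding restrict_to_def by blast
  then have 1: "N \<union> max_elems ?R \<subseteq> B - max_elems B"
    using NR by blast
  have 2: "I \<subseteq> J \<or> J \<subseteq> I \<or> I \<inter> J = {}"
    if "I \<in> N \<union> max_elems ?R" "J \<in> N \<union> max_elems ?R" for I J
  proof (cases "I \<in> max_elems ?R \<or> J \<in> max_elems ?R")
    case True
    then show ?thesis
      using max_elems_subset_or_disjoint[OF R, of I J] max_elems_subset_or_disjoint[OF R, of J I]
        that NR by blast
  next
    case False
    then show ?thesis
      using nested_collection_laminar[OF N, of I J] that by blast
  qed
  have 3: "\<Union>C \<notin> B"
    if C: "C \<subseteq> N \<union> max_elems ?R" "2 \<le> card C" "disjoint C" for C
  proof
    assume "\<Union>C \<in> B"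
    moreover have "\<Union>C \<subseteq> S"
      using C(1) NR unfolding restrict_to_def by blast
    ultimately have CR: "\<Union>C \<in> ?R"
      unfolding restrict_to_def by blast
    show False
    proof (cases "C \<subseteq> N")
      case True
      then show False
        using nested_collection_Union_notin[OF N _ C(2,3)] CR by blast
    next
      case False
      then obtain M where M: "M \<in> C" "M \<in> max_elems ?R"
        using C(1) by blast
      \<comment> \<open>With the union absorbed by \<open>M\<close>, any other member of
        \<open>C\<close> is both inside \<open>M\<close> and disjoint from it, hence empty, which a
        building set excludes.\<close>
      then have "\<Union>C = M"
        using max_elems_eqI[OF M(2) CR] by blast
      moreover have "C \<noteq> {M}"
        using C(2) by auto
      then obtain I where I: "I \<in> C" "I \<noteq> M"
        using M(1) by blast
      moreover have "I \<inter> M = {}"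
        using disjointD[OF C(3) I(1) M(1) I(2)] .
      ultimately have "I = {}"
        by blast
      moreover have "I \<in> ?R"
        using I(1) C(1) NR by blast
      ultimately show False
        using R unfolding building_set_def by blast
    qed
  qed
  from 1 2 3 show ?thesis
    unfolding nested_collection_def by simp
qed

text \<open>Each singleton lies below a maximal member, so the maximal members alone already cover
  the ground set. Applied to the restriction to \<open>S\<close>, this shows that the inverse map
  yields collections with union \<open>S\<close>.\<close>

lemma Union_Un_max_elems:
  assumes "finite X" "building_set X B" "N \<subseteq> B"
  shows "\<Union>(N \<union> max_elems B) = X"
proof
  show "\<Union>(N \<union> max_elems B) \<subseteq> X"
    using assms(2,3) max_elems_subset[of B] unfolding building_set_def by blast
  show "X \<subseteq> \<Union>(N \<union> max_elems B)"
  proof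
    fix x assume "x \<in> X"
    then have "{x} \<in> B"
      using assms(2) unfolding building_set_def by blast
    then obtain M where "M \<in> max_elems B" "{x} \<subseteq> M"
      using ex_max_elem_superset[OF finite_building_set[OF assms(1,2)]] by metis
    then show "x \<in> \<Union>(N \<union> max_elems B)"
      by blast
  qed
qed

section \<open>Summation over the fibres of the union map\<close>

lemma sum_nested_collections_with_Union:
  assumes fin: "finite X" and bs: "building_set X B" and S: "S \<in> proper_trace_subsets X B"
  shows "(\<Sum>N\<in>{N \<in> nested_complex B. \<Union>N = S}. monom 1 (card N)) =
    monom 1 (card (max_elems (restrict_to B S))) * f_polynomial (nested_complex (restrict_to B S))"
proof -
  let ?R = "restrict_to B S"
  have "S \<subseteq> X"
    using S unfolding proper_trace_subsets_def by blast
  then have R: "finite S" "building_set S ?R"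
    using building_set_restrict_to[OF bs] fin by (auto intro: finite_subset)
  have sub: "N \<subseteq> ?R - max_elems ?R" if "N \<in> nested_complex ?R" for N
    using that nested_collection_subset unfolding nested_complex_def by simp
  have "(\<Sum>N\<in>{N \<in> nested_complex B. \<Union>N = S}. monom (1::int) (card N)) =
      (\<Sum>N\<in>nested_complex ?R. monom 1 (card (max_elems ?R)) * monom 1 (card N))"
  proof (rule sum.reindex_bij_witness
      [where i = "\<lambda>N. N \<union> max_elems ?R" and j = "\<lambda>N. N - max_elems ?R"])
    fix N assume "N \<in> {N \<in> nested_complex B. \<Union>N = S}"
    then have N: "nested_collection B N" "\<Union>N = S"
      unfolding nested_complex_def by auto
    have max_sub: "max_elems ?R \<subseteq> N"
      using max_elems_restrict_to_Union_subset[OF fin bs N(1)] N(2) by simp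
    then show "N - max_elems ?R \<union> max_elems ?R = N"
      by blast
    show "N - max_elems ?R \<in> nested_complex ?R"
      using nested_collection_Diff_max_elems[OF N(1)] N(2) unfolding nested_complex_def by simp
    have "finite N"
      using nested_collection_subset[OF N(1)] finite_building_set[OF fin bs]
      by (meson finite_Diff finite_subset)
    \<comment> \<open>The bijection lowers every cardinality in the fibre by the same number, which
      becomes the monomial factor in front.\<close>
    then have "card N = card (max_elems ?R) + card (N - max_elems ?R)"
      using max_sub by (metis card_Diff_subset card_mono finite_subset le_add_diff_inverse)
    then show "monom (1::int) (card (max_elems ?R)) * monom 1 (card (N - max_elems ?R)) =
        monom 1 (card N)"
      by (simp add: mult_monom)
  next
    fix N assume N: "N \<in> nested_complex ?R"
    show "N \<union> max_elems ?R - max_elems ?R = N"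
      using sub[OF N] by blast
    have "nested_collection B (N \<union> max_elems ?R)"
      using nested_collection_Un_max_elems[OF bs S] N unfolding nested_complex_def by blast
    moreover have "\<Union>(N \<union> max_elems ?R) = S"
      using Union_Un_max_elems[OF R] sub[OF N] by blast
    ultimately show "N \<union> max_elems ?R \<in> {N \<in> nested_complex B. \<Union>N = S}"
      unfolding nested_complex_def by blast
  qed
  then show ?thesis
    unfolding f_polynomial_def by (simp add: sum_distrib_left)
qed

text \<open>The recursion is stated for nonempty \<open>X\<close>: when \<open>X\<close> is empty,
  \<open>proper_trace_subsets X B\<close> is empty and the sum would be 0, whereas the polynomial is
  1. That base value is the first conjunct.\<close>

theorem theorem5p1:
  fixes X :: "'a set" and B :: "'a set set"
  assumes "finite X" and "building_set X B"
  shows "f_polynomial (nested_complex ({} :: 'a set set)) = 1 \<and>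
    (X \<noteq> {} \<longrightarrow>
      f_polynomial (nested_complex B) =
        (\<Sum>S\<in>proper_trace_subsets X B.
           monom 1 (card (max_elems (restrict_to B S))) *
           f_polynomial (nested_complex (restrict_to B S))))"
proof (intro conjI impI)
  have "nested_complex ({} :: 'a set set) = {{}}"
    using empty_in_nested_complex nested_collection_subset unfolding nested_complex_def by fastforce
  then show "f_polynomial (nested_complex ({} :: 'a set set)) = 1"
    by (simp add: f_polynomial_def)
next
  assume "X \<noteq> {}"
  have "finite (proper_trace_subsets X B)"
    by (rule finite_subset[of _ "Pow X"]) (use assms(1) in \<open>auto simp: proper_trace_subsets_def\<close>)
  moreover have "\<Union> ` nested_complex B \<subseteq> proper_trace_subsets X B"
    using Union_nested_collection_in_proper_trace_subsets[OF assms \<open>X \<noteq> {}\<close>]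
    unfolding nested_complex_def by blast
  \<comment> \<open>Each nested collection lies in exactly one fibre of the union map, and the
    inclusion just shown lets the fibres be indexed by
    \<open>proper_trace_subsets X B\<close>.\<close>
  ultimately have "f_polynomial (nested_complex B) =
      (\<Sum>S\<in>proper_trace_subsets X B. \<Sum>N\<in>{N \<in> nested_complex B. \<Union>N = S}. monom 1 (card N))"
    unfolding f_polynomial_def
    by (intro sum.group[symmetric] finite_nested_complex[OF assms])
  also have "\<dots> = (\<Sum>S\<in>proper_trace_subsets X B.
      monom 1 (card (max_elems (restrict_to B S))) *
      f_polynomial (nested_complex (restrict_to B S)))"
    using sum_nested_collections_with_Union[OF assms] by (intro sum.cong refl)
  finally show "f_polynomial (nested_complex B) =
      (\<Sum>S\<in>proper_trace_subsets X B.
        monom 1 (card (max_elems (restrict_to B S))) *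
        f_polynomial (nested_complex (restrict_to B S)))" .
qed

end
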